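(* Let $k\ge 2$ be a constant. There are constants $c_1,c_2>0$ (depending only on $k$) such that for every $n$ and every $f\colon\{0,1\}^n\to\{0,1\}$ with $f\in Q_k$, letting $\mathrm{CC}(f)$ be the communication complexity of the $Q_k$-communication game for $f$ and $D(f)$ the minimal $d$ for which there exists a circuit $C\le f$ of depth $d$ consisting only of $\mathrm{THR}^{k+1}_2$ gates and variables, we have $c_1 D(f)\le \mathrm{CC}(f)\le c_2 D(f)$ (i.e. the two quantities are equal up to constant factors).
   Context: $Q_k$ is the set of Boolean functions $f\colon\{0,1\}^n\to\{0,1\}$ such that for all $x^1,\dots,x^k\in f^{-1}(0)$ there is a coordinate $i$ with $x^1_i=\dots=x^k_i=0$. $\mathrm{THR}^{k+1}_2$ outputs $1$ iff at least $2$ of its $k+1$ input bits are $1$. A circuit consisting only of $\mathrm{THR}^{k+1}_2$ gates and variables is a directed acyclic graph with an output node, internal nodes being $\mathrm{THR}^{k+1}_2$ gates with $k+1$ ordered inputs, and input nodes labeled by variables $x_i$ (no constants, no negations); depth is the maximal length of a path from the output node to an input node. For a circuit $C$ and function $f$ we write $C\le f$ if $C(x)=0$ for every $x\in f^{-1}(0)$. The $Q_k$-communication game for $f$ is the following $k$-party number-in-hand problem: party $j$ receives $x^j\in f^{-1}(0)$, and the parties must output some $i\in[n]$ with $x^1_i=\dots=x^k_i=0$. Protocols are deterministic: at each step one party, depending on the communication so far and its own input, broadcasts one bit to all parties; its communication complexity is the minimum, over protocols that always output a correct answer, of the maximal number of bits communicated (the depth of the protocol tree). *)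

theory Defs
  imports "HOL-Library.Extended_Real"
begin

text \<open>
  Bit strings in \<open>{0,1}\<^sup>n\<close> are Boolean lists of length \<open>n\<close>; coordinates and parties are numbered
  from 0. A function \<open>{0,1}\<^sup>n \<rightarrow> {0,1}\<close> is a function on all Boolean lists of which only
  the values on lists of length \<open>n\<close> are ever used.
\<close>

definition zeros :: "nat \<Rightarrow> (bool list \<Rightarrow> bool) \<Rightarrow> bool list set" where
  "zeros n f = {x. length x = n \<and> \<not> f x}"

definition Q :: "nat \<Rightarrow> nat \<Rightarrow> (bool list \<Rightarrow> bool) set" where
  "Q k n = {f. \<forall>X :: nat \<Rightarrow> bool list. (\<forall>j<k. X j \<in> zeros n f) \<longrightarrow>
      (\<exists>i<n. \<forall>j<k. \<not> X j ! i)}"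


subsection \<open>Threshold circuits\<close>

definition THR :: "nat \<Rightarrow> bool list \<Rightarrow> bool" where
  "THR t bs \<longleftrightarrow> t \<le> count_list bs True"

text \<open>A gate is labelled with the ordered list of the nodes feeding it (repetitions allowed).\<close>

datatype label = Var nat | Gate "nat list"

record circuit =
  nodes :: "nat set"
  label :: "nat \<Rightarrow> label"
  out :: nat

text \<open>Pairs \<open>(u, v)\<close> such that \<open>u\<close> is an input of the gate \<open>v\<close>.\<close>

definition wires :: "circuit \<Rightarrow> (nat \<times> nat) set" where
  "wires C = {(u, v). v \<in> nodes C \<and> (\<exists>us. label C v = Gate us \<and> u \<in> set us)}"

definition thr2_circuit :: "nat \<Rightarrow> nat \<Rightarrow> circuit \<Rightarrow> bool" where
  "thr2_circuit k n C \<longleftrightarrow>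
     finite (nodes C) \<and> out C \<in> nodes C \<and> acyclic (wires C) \<and>
     (\<forall>v\<in>nodes C. case label C v of
         Var i \<Rightarrow> i < n
       | Gate us \<Rightarrow> length us = k + 1 \<and> set us \<subseteq> nodes C)"

definition node_value :: "circuit \<Rightarrow> bool list \<Rightarrow> nat \<Rightarrow> bool" where
  "node_value C x = wfrec (wires C) (\<lambda>val v. case label C v of
       Var i \<Rightarrow> x ! i
     | Gate us \<Rightarrow> THR 2 (map val us))"

definition circuit_value :: "circuit \<Rightarrow> bool list \<Rightarrow> bool" where
  "circuit_value C x = node_value C x (out C)"

definition circuit_below :: "nat \<Rightarrow> circuit \<Rightarrow> (bool list \<Rightarrow> bool) \<Rightarrow> bool" where
  "circuit_below n C f \<longleftrightarrow> (\<forall>x\<in>zeros n f. \<not> circuit_value C x)"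

definition circuit_depth :: "circuit \<Rightarrow> nat" where
  "circuit_depth C =
     Max {l. \<exists>v\<in>nodes C. (\<exists>i. label C v = Var i) \<and> (v, out C) \<in> wires C ^^ l}"

text \<open>
  The infimum is \<open>\<infinity>\<close> if there is no such circuit. For \<open>f \<in> Q k n\<close>, \<open>k \<ge> 2\<close> this happens only
  for \<open>n = 0\<close> (and \<open>f\<close> constantly 1), where there are no variables; there are no
  protocols in that case either.
\<close>

definition min_depth :: "nat \<Rightarrow> nat \<Rightarrow> (bool list \<Rightarrow> bool) \<Rightarrow> enat" where
  "min_depth k n f =
     (INF C \<in> {C. thr2_circuit k n C \<and> circuit_below n C f}. enat (circuit_depth C))"


subsection \<open>The communication game\<close>

text \<open>
  A node of the protocol tree represents the communication so far. In \<open>Speak j b P0 P1\<close>,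
  party \<open>j\<close> holding \<open>x\<close> broadcasts the bit \<open>b x\<close>, and the protocol continues
  with \<open>P1\<close> if the bit is 1 and with \<open>P0\<close> otherwise.
\<close>

datatype protocol = Output nat | Speak nat "bool list \<Rightarrow> bool" protocol protocol

fun well_formed :: "nat \<Rightarrow> nat \<Rightarrow> protocol \<Rightarrow> bool" where
  "well_formed k n (Output i) \<longleftrightarrow> i < n"
| "well_formed k n (Speak j b P0 P1) \<longleftrightarrow> j < k \<and> well_formed k n P0 \<and> well_formed k n P1"

fun result :: "protocol \<Rightarrow> (nat \<Rightarrow> bool list) \<Rightarrow> nat" where
  "result (Output i) X = i"
| "result (Speak j b P0 P1) X = (if b (X j) then result P1 X else result P0 X)"

fun protocol_depth :: "protocol \<Rightarrow> nat" where
  "protocol_depth (Output i) = 0"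
| "protocol_depth (Speak j b P0 P1) = Suc (max (protocol_depth P0) (protocol_depth P1))"

definition solves_game :: "nat \<Rightarrow> nat \<Rightarrow> (bool list \<Rightarrow> bool) \<Rightarrow> protocol \<Rightarrow> bool" where
  "solves_game k n f P \<longleftrightarrow>
     well_formed k n P \<and>
     (\<forall>X. (\<forall>j<k. X j \<in> zeros n f) \<longrightarrow> (\<forall>j<k. \<not> X j ! result P X))"

definition CC :: "nat \<Rightarrow> nat \<Rightarrow> (bool list \<Rightarrow> bool) \<Rightarrow> enat" where
  "CC k n f = (INF P \<in> {P. solves_game k n f P}. enat (protocol_depth P))"


subsection \<open>Well-definedness\<close>

lemma wf_wires: "thr2_circuit k n C \<Longrightarrow> wf (wires C)"
proof -
  assume C: "thr2_circuit k n C"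
  have "wires C \<subseteq> nodes C \<times> nodes C"
    using C by (fastforce simp: thr2_circuit_def wires_def split: label.splits)
  moreover have "finite (nodes C \<times> nodes C)"
    using C by (simp add: thr2_circuit_def)
  ultimately show ?thesis
    using C finite_subset by (auto simp: thr2_circuit_def intro!: finite_acyclic_wf)
qed

lemma node_value_unfold:
  assumes "thr2_circuit k n C" "v \<in> nodes C"
  shows "node_value C x v = (case label C v of
       Var i \<Rightarrow> x ! i
     | Gate us \<Rightarrow> THR 2 (map (node_value C x) us))"
proof -
  have "node_value C x v = (case label C v of
       Var i \<Rightarrow> x ! i
     | Gate us \<Rightarrow> THR 2 (map (cut (node_value C x) (wires C) v) us))"
    unfolding node_value_def by (rule wfrec[OF wf_wires[OF assms(1)]])
  moreover have "map (cut (node_value C x) (wires C) v) us = map (node_value C x) us"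
    if "label C v = Gate us" for us
    using that assms(2) by (auto simp: cut_def wires_def)
  ultimately show ?thesis by (cases "label C v") (simp_all cong: map_cong)
qed

lemma depth_set_finite_nonempty:
  assumes "thr2_circuit k n C"
  defines "L \<equiv> {l. \<exists>v\<in>nodes C. (\<exists>i. label C v = Var i) \<and> (v, out C) \<in> wires C ^^ l}"
  shows "finite L" "L \<noteq> {}"
proof -
  note C = assms(1)[unfolded thr2_circuit_def]
  have fin: "finite {l. \<exists>u. (u, v) \<in> wires C ^^ l}" for v
    using wf_wires[OF assms(1)]
  proof (induction v rule: wf_induct_rule)
    case (less v)
    have "finite {w. (w, v) \<in> wires C}"
    proof (rule finite_subset)
      show "{w. (w, v) \<in> wires C} \<subseteq> (case label C v of Var i \<Rightarrow> {} | Gate us \<Rightarrow> set us)"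
        by (auto simp: wires_def)
    qed (simp split: label.splits)
    then have "finite (\<Union>w\<in>{w. (w, v) \<in> wires C}. {l. \<exists>u. (u, w) \<in> wires C ^^ l})"
      using less by blast
    moreover have "{l. \<exists>u. (u, v) \<in> wires C ^^ l} \<subseteq>
      insert 0 (Suc ` (\<Union>w\<in>{w. (w, v) \<in> wires C}. {l. \<exists>u. (u, w) \<in> wires C ^^ l}))"
    proof
      fix l assume "l \<in> {l. \<exists>u. (u, v) \<in> wires C ^^ l}"
      then show "l \<in> insert 0 (Suc ` (\<Union>w\<in>{w. (w, v) \<in> wires C}. {l. \<exists>u. (u, w) \<in> wires C ^^ l}))"
        by (cases l) auto
    qed
    ultimately show ?case
      using finite_subset by blast
  qed
  show "finite L"
    using fin[of "out C"] unfolding L_def by (rule rev_finite_subset) auto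
  have "v \<in> nodes C \<Longrightarrow> \<exists>l. \<exists>u\<in>nodes C. (\<exists>i. label C u = Var i) \<and> (u, v) \<in> wires C ^^ l" for v
    using wf_wires[OF assms(1)]
  proof (induction v rule: wf_induct_rule)
    case (less v)
    show ?case
    proof (cases "label C v")
      case (Var i)
      then have "(v, v) \<in> wires C ^^ 0" by simp
      with Var less.prems show ?thesis by blast
    next
      case (Gate us)
      with C less.prems have us: "length us = k + 1" "set us \<subseteq> nodes C"
        by (auto split: label.splits)
      then obtain w where w: "w \<in> set us" by (cases us) auto
      with Gate less.prems have wv: "(w, v) \<in> wires C" by (auto simp: wires_def)
      with less.IH w us obtain l u where "u \<in> nodes C" "\<exists>i. label C u = Var i"
        "(u, w) \<in> wires C ^^ l" by blast
      with wv have "(u, v) \<in> wires C ^^ Suc l" by auto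
      with \<open>u \<in> nodes C\<close> \<open>\<exists>i. label C u = Var i\<close> show ?thesis by blast
    qed
  qed
  with C show "L \<noteq> {}" unfolding L_def by blast
qed

lemma CC_finite:
  assumes "0 < n" "f \<in> Q k n"
  shows "CC k n f < \<infinity>"
proof -
  have query: "\<exists>P. well_formed k n P \<and> (\<forall>X. result P X = g (map (\<lambda>(j, i). X j ! i) qs))"
    if "\<forall>(j, i)\<in>set qs. j < k" "range g \<subseteq> {..<n}"
    for qs :: "(nat \<times> nat) list" and g :: "bool list \<Rightarrow> nat"
    using that
  proof (induction qs arbitrary: g)
    case Nil
    then show ?case by (intro exI[of _ "Output (g [])"]) auto
  next
    case (Cons q qs)
    obtain j i where q: "q = (j, i)" by force
    have "\<exists>P. well_formed k n P \<and>
        (\<forall>X. result P X = g (a # map (\<lambda>(j, i). X j ! i) qs))" for a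
      using Cons.IH[of "\<lambda>as. g (a # as)"] Cons.prems by auto
    then obtain P where "\<And>a. well_formed k n (P a)"
        "\<And>a X. result (P a) X = g (a # map (\<lambda>(j, i). X j ! i) qs)"
      by metis
    then show ?case
      using Cons.prems q
      by (intro exI[of _ "Speak j (\<lambda>x. x ! i) (P False) (P True)"]) auto
  qed
  define qs where "qs = List.product [0..<k] [0..<n]"
  define view :: "(nat \<Rightarrow> bool list) \<Rightarrow> bool list"
    where "view X = map (\<lambda>(j, i). X j ! i) qs" for X
  have view: "X j ! i = Y j ! i" if "view X = view Y" "j < k" "i < n" for X Y i j
    using that by (auto simp: view_def qs_def)
  define good where "good a i \<longleftrightarrow>
    i < n \<and> (\<forall>X. (\<forall>j<k. X j \<in> zeros n f) \<longrightarrow> view X = a \<longrightarrow> (\<forall>j<k. \<not> X j ! i))" for a i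
  have "\<exists>i. good a i" for a
  proof (cases "\<exists>X. (\<forall>j<k. X j \<in> zeros n f) \<and> view X = a")
    case True
    then obtain X where X: "\<forall>j<k. X j \<in> zeros n f" "view X = a" by blast
    with assms(2) obtain i where "i < n" "\<forall>j<k. \<not> X j ! i" by (auto simp: Q_def)
    with X view show ?thesis unfolding good_def by metis
  next
    case False
    with assms(1) show ?thesis unfolding good_def by blast
  qed
  then obtain g where g: "\<And>a. good a (g a)" by metis
  have "\<exists>P. well_formed k n P \<and> (\<forall>X. result P X = g (view X))"
    unfolding view_def by (rule query) (use g in \<open>auto simp: qs_def good_def\<close>)
  then obtain P where "well_formed k n P" "\<And>X. result P X = g (view X)" by blast
  with g have "solves_game k n f P" by (auto simp: solves_game_def good_def)
  then have "CC k n f \<le> enat (protocol_depth P)"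
    unfolding CC_def by (intro INF_lower) simp
  then show ?thesis
    using enat_ord_simps(4) le_less_trans by blast
qed

end

theory Submission imports Defs "HOL-Library.Countable" begin

text \<open>
  At a gate with value 0 on the inputs of all \<open>k\<close> parties, each party sees at most one child with
  value 1, so one of the \<open>k + 1\<close> children has value 0 for everybody; the parties find it with
  \<open>k (k + 1)\<close> bits and descend.

  Conversely, a tree of threshold gates that vanishes on \<open>f\<^sup>-\<^sup>1(0)\<close> is a strategy for learning a zero
  coordinate of an unknown \<open>x \<in> f\<^sup>-\<^sup>1(0)\<close> by asking for one of \<open>k + 1\<close> disjoint hypotheses to be
  refuted. Any information on \<open>x\<close> with boundedly many values can be cut down to \<open>k\<close> possible values
  in boundedly many rounds. If only \<open>k\<close> labels remain possible for \<open>x\<close>, there are at most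
  \<open>k ^ k\<close> tuples of labels for the \<open>k\<close> parties, and the learner simulates the protocol for all of
  them at once: refine the labels by the next bit sent in each simulation, then cut down again.
  When the protocol has ended, its output depends on the labels only. Take inputs of the parties
  that exhaust the labels: the output is a zero coordinate of the unknown \<open>x\<close>, since \<open>x\<close> may replace
  the input that has the same label.
\<close>

section \<open>Gates of threshold 2\<close>

lemma THR_iff_card: "THR t bs \<longleftrightarrow> t \<le> card {i. i < length bs \<and> bs ! i}"
proof -
  have "count_list bs True = length (filter (\<lambda>b. b) bs)"
    by (induction bs) auto
  then show ?thesis by (simp add: THR_def length_filter_conv_card)
qed

text \<open>Here j is the only place where a 1 may stand. It may lie beyond the end of the list, so
  the case without any 1 needs no separate clause.\<close>

lemma not_THR2_iff:
  "\<not> THR 2 bs \<longleftrightarrow> (\<exists>j. \<forall>i<length bs. i \<noteq> j \<longrightarrow> \<not> bs ! i)"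
proof -
  let ?A = "{i. i < length bs \<and> bs ! i}"
  have "card ?A \<le> 1 \<longleftrightarrow> (\<exists>j. ?A \<subseteq> {j})"
  proof
    assume "card ?A \<le> 1"
    then show "\<exists>j. ?A \<subseteq> {j}"
      by (cases "?A = {}") (auto simp: card_le_Suc0_iff_eq)
  next
    assume "\<exists>j. ?A \<subseteq> {j}"
    then obtain j where "?A \<subseteq> {j}" by blast
    then have "card ?A \<le> card {j}" by (intro card_mono) simp_all
    then show "card ?A \<le> 1" by simp
  qed
  moreover have "\<not> THR 2 bs \<longleftrightarrow> card ?A \<le> 1"
    unfolding THR_iff_card by linarith
  ultimately show ?thesis by blast
qed


subsection \<open>From circuits to protocols\<close>

text \<open>A non-adaptive block of announcements: no question depends on earlier answers, so the
  continuation can be a function of the complete answer list.\<close>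

fun ask :: "(nat \<times> (bool list \<Rightarrow> bool)) list \<Rightarrow> (bool list \<Rightarrow> protocol) \<Rightarrow> protocol" where
  "ask [] F = F []"
| "ask ((j, b) # qs) F = Speak j b (ask qs (\<lambda>as. F (False # as))) (ask qs (\<lambda>as. F (True # as)))"

lemma well_formed_ask:
  "\<lbrakk>\<forall>(j, b) \<in> set qs. j < k; \<And>as. well_formed k n (F as)\<rbrakk> \<Longrightarrow> well_formed k n (ask qs F)"
  by (induction qs F rule: ask.induct) auto

lemma protocol_depth_ask:
  "(\<And>as. protocol_depth (F as) \<le> D) \<Longrightarrow> protocol_depth (ask qs F) \<le> length qs + D"
  by (induction qs F rule: ask.induct) auto

lemma result_ask:
  "result (ask qs F) X = result (F (map (\<lambda>(j, b). b (X j)) qs)) X"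
  by (induction qs F rule: ask.induct) auto

lemma gate_protocol:
  assumes "length us = k + 1"
  and wf: "\<And>u. u \<in> set us \<Longrightarrow> well_formed k n (Pr u)"
  and depth: "\<And>u. u \<in> set us \<Longrightarrow> protocol_depth (Pr u) \<le> D"
  and correct: "\<And>u X. \<lbrakk>u \<in> set us; \<forall>j<k. X j \<in> S \<and> \<not> val (X j) u\<rbrakk> \<Longrightarrow> \<forall>j<k. \<not> X j ! result (Pr u) X"
  shows "\<exists>P. well_formed k n P \<and> protocol_depth P \<le> k * (k + 1) + D \<and>
    (\<forall>X. (\<forall>j<k. X j \<in> S \<and> \<not> THR 2 (map (val (X j)) us)) \<longrightarrow> (\<forall>j<k. \<not> X j ! result P X))"
proof -
  define qs where "qs = map (\<lambda>(j, u). (j, \<lambda>x. val x u)) (List.product [0..<k] us)"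
  define answers where "answers X = map (\<lambda>(j, b). b (X j)) qs" for X :: "nat \<Rightarrow> bool list"
  define good where "good as u \<longleftrightarrow> u \<in> set us \<and>
    (\<forall>X. answers X = as \<longrightarrow> (\<forall>j<k. \<not> val (X j) u))" for as u
  \<comment> \<open>All parties must agree on the child, so it depends on the answers alone. The
    default \<open>hd us\<close> serves answer lists without a good child and keeps \<open>P\<close>
    well formed.\<close>
  define ch where "ch as = (if \<exists>u. good as u then SOME u. good as u else hd us)" for as
  have "us \<noteq> []" using assms(1) by auto
  have ch_good: "good as (ch as)" if "good as u" for as u
    using that unfolding ch_def by (auto intro: someI)
  have ch: "ch as \<in> set us" for as
  proof (cases "\<exists>u. good as u")
    case True
    then show ?thesis using ch_good good_def by blast
  next
    case False
    then show ?thesis using \<open>us \<noteq> []\<close> by (simp add: ch_def)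
  qed
  define P where "P = ask qs (\<lambda>as. Pr (ch as))"
  have "well_formed k n P" unfolding P_def
    by (rule well_formed_ask) (use wf ch in \<open>auto simp: qs_def\<close>)
  moreover have "protocol_depth P \<le> k * (k + 1) + D"
    using protocol_depth_ask[of "\<lambda>as. Pr (ch as)" D qs] depth ch assms(1)
    by (simp add: P_def qs_def)
  moreover have "\<forall>j<k. \<not> X j ! result P X"
    if X: "\<forall>j<k. X j \<in> S \<and> \<not> THR 2 (map (val (X j)) us)" for X
  proof -
    from X obtain e where e: "\<And>j i. \<lbrakk>j < k; i < k + 1; i \<noteq> e j\<rbrakk> \<Longrightarrow> \<not> val (X j) (us ! i)"
      unfolding not_THR2_iff using assms(1) by (simp, metis)
    \<comment> \<open>Pigeonhole: party j can see a 1 only at child \<open>e j\<close>, and k such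
      positions do not cover k + 1 children.\<close>
    have "card (e ` {..<k}) < card {..<k + 1}"
      using card_image_le[of "{..<k}" e] by simp
    then have "\<not> {..<k + 1} \<subseteq> e ` {..<k}"
      by (meson card_mono finite_imageI finite_lessThan not_le)
    then obtain i where i: "i < k + 1" "i \<notin> e ` {..<k}" by auto
    have same: "val (Y j) u = val (X j) u"
      if "answers Y = answers X" "j < k" "u \<in> set us" for Y j u
      using that by (auto simp: answers_def qs_def)
    have "good (answers X) (us ! i)"
      unfolding good_def using i e same assms(1) by (metis imageI lessThan_iff nth_mem)
    then have "good (answers X) (ch (answers X))" by (rule ch_good)
    with X have "\<forall>j<k. \<not> X j ! result (Pr (ch (answers X))) X"
      by (intro correct) (auto simp: good_def)
    then show ?thesis by (simp add: P_def result_ask answers_def)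
  qed
  ultimately show ?thesis by blast
qed

text \<open>The depth of a circuit is defined from the output only. A witness path of length
  \<open>l\<close> from a variable to \<open>v\<close> measures the cost at inner nodes, and at the
  output it is bounded by the depth.\<close>

lemma protocol_of_node:
  assumes C: "thr2_circuit k n C" and "v \<in> nodes C"
  shows "\<exists>P l u. well_formed k n P \<and> u \<in> nodes C \<and> (\<exists>i. label C u = Var i) \<and>
    (u, v) \<in> wires C ^^ l \<and> protocol_depth P \<le> k * (k + 1) * l \<and>
    (\<forall>X. (\<forall>j<k. \<not> node_value C (X j) v) \<longrightarrow> (\<forall>j<k. \<not> X j ! result P X))"
  using wf_wires[OF C] assms(2)
proof (induction v rule: wf_induct_rule)
  case (less v)
  note val = node_value_unfold[OF C less.prems]
  show ?case
  proof (cases "label C v")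
    case (Var i)
    with C less.prems have "i < n" by (auto simp: thr2_circuit_def split: label.splits)
    with Var val less.prems show ?thesis
      by (intro exI[of _ "Output i"] exI[of _ 0] exI[of _ v]) auto
  next
    case (Gate us)
    with C less.prems have us: "length us = k + 1" "set us \<subseteq> nodes C"
      by (auto simp: thr2_circuit_def split: label.splits)
    have wire: "(w, v) \<in> wires C" if "w \<in> set us" for w
      using that Gate less.prems by (auto simp: wires_def)
    have "\<forall>w\<in>set us. \<exists>P l u. well_formed k n P \<and> u \<in> nodes C \<and> (\<exists>i. label C u = Var i) \<and>
      (u, w) \<in> wires C ^^ l \<and> protocol_depth P \<le> k * (k + 1) * l \<and>
      (\<forall>X. (\<forall>j<k. \<not> node_value C (X j) w) \<longrightarrow> (\<forall>j<k. \<not> X j ! result P X))"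
      using less.IH wire us by blast
    then obtain Pr L U where Pr: "\<And>w. w \<in> set us \<Longrightarrow> well_formed k n (Pr w) \<and> U w \<in> nodes C \<and>
      (\<exists>i. label C (U w) = Var i) \<and>
      (U w, w) \<in> wires C ^^ L w \<and> protocol_depth (Pr w) \<le> k * (k + 1) * L w \<and>
      (\<forall>X. (\<forall>j<k. \<not> node_value C (X j) w) \<longrightarrow> (\<forall>j<k. \<not> X j ! result (Pr w) X))"
      by metis
    \<comment> \<open>The witness path goes through a child whose own path is longest, so that
      \<open>m\<close> bounds the cost below every child.\<close>
    define m where "m = Max (L ` set us)"
    have "us \<noteq> []" using us by auto
    then have "m \<in> L ` set us" unfolding m_def by (intro Max_in) auto
    then obtain w where w: "w \<in> set us" "L w = m" by auto
    have le: "L u \<le> m" if "u \<in> set us" for u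
      unfolding m_def using that by simp
    have "\<exists>P. well_formed k n P \<and> protocol_depth P \<le> k * (k + 1) + k * (k + 1) * m \<and>
      (\<forall>X. (\<forall>j<k. X j \<in> UNIV \<and> \<not> THR 2 (map (node_value C (X j)) us)) \<longrightarrow>
        (\<forall>j<k. \<not> X j ! result P X))"
    proof (rule gate_protocol[OF us(1), of n Pr])
      fix u assume u: "u \<in> set us"
      have "k * (k + 1) * L u \<le> k * (k + 1) * m" using le[OF u] by (rule mult_le_mono2)
      with Pr[OF u] show "protocol_depth (Pr u) \<le> k * (k + 1) * m" by linarith
    qed (use Pr in auto)
    then obtain P where P: "well_formed k n P" "protocol_depth P \<le> k * (k + 1) + k * (k + 1) * m"
      "\<And>X. (\<forall>j<k. \<not> THR 2 (map (node_value C (X j)) us)) \<Longrightarrow> (\<forall>j<k. \<not> X j ! result P X)"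
      by auto
    have "(U w, v) \<in> wires C ^^ Suc m" using Pr[OF w(1)] wire[OF w(1)] w by auto
    moreover have "protocol_depth P \<le> k * (k + 1) * Suc m" using P(2) by simp
    moreover have "\<forall>X. (\<forall>j<k. \<not> node_value C (X j) v) \<longrightarrow> (\<forall>j<k. \<not> X j ! result P X)"
      using P(3) val Gate by simp
    ultimately show ?thesis using Pr[OF w(1)] P(1) by blast
  qed
qed

lemma CC_le_circuit_depth:
  assumes C: "thr2_circuit k n C" and below: "circuit_below n C f"
  shows "CC k n f \<le> enat (k * (k + 1) * circuit_depth C)"
proof -
  from C have "out C \<in> nodes C" by (simp add: thr2_circuit_def)
  from protocol_of_node[OF C this] obtain P l u where P: "well_formed k n P" "u \<in> nodes C"
    "\<exists>i. label C u = Var i" "(u, out C) \<in> wires C ^^ l" "protocol_depth P \<le> k * (k + 1) * l"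
    "\<And>X. (\<forall>j<k. \<not> node_value C (X j) (out C)) \<Longrightarrow> (\<forall>j<k. \<not> X j ! result P X)"
    by blast
  have "l \<le> circuit_depth C"
    unfolding circuit_depth_def using P
    by (intro Max_ge depth_set_finite_nonempty(1)[OF C]) blast
  then have "k * (k + 1) * l \<le> k * (k + 1) * circuit_depth C" by (rule mult_le_mono2)
  with P(5) have "protocol_depth P \<le> k * (k + 1) * circuit_depth C" by linarith
  moreover have "solves_game k n f P"
    using P(1,6) below by (auto simp: solves_game_def circuit_below_def circuit_value_def)
  ultimately show ?thesis
    unfolding CC_def by (intro INF_lower2[of P]) auto
qed


subsection \<open>From learning strategies to circuits\<close>

text \<open>
  A learner partitions the set \<open>S\<close> of inputs that are still possible into \<open>k + 1\<close> hypotheses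
  (the colours of \<open>c\<close>), and an adversary names one of them that is false. After \<open>h\<close> rounds the
  learner must know a coordinate in which the input is 0.
\<close>

fun learnable :: "nat \<Rightarrow> nat \<Rightarrow> nat \<Rightarrow> bool list set \<Rightarrow> bool" where
  "learnable k n 0 S \<longleftrightarrow> (\<exists>v<n. \<forall>x\<in>S. \<not> x ! v)"
| "learnable k n (Suc h) S \<longleftrightarrow> (\<exists>c :: bool list \<Rightarrow> nat. \<forall>i\<le>k. learnable k n h {x \<in> S. c x \<noteq> i})"

lemma learnable_subset: "learnable k n h S \<Longrightarrow> T \<subseteq> S \<Longrightarrow> learnable k n h T"
proof (induction h arbitrary: S T)
  case (Suc h)
  from Suc.prems(1) obtain c :: "bool list \<Rightarrow> nat" where "\<forall>i\<le>k. learnable k n h {x \<in> S. c x \<noteq> i}" by auto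
  then have "\<forall>i\<le>k. learnable k n h {x \<in> T. c x \<noteq> i}"
    using Suc.prems(2) by (blast intro: Suc.IH)
  then show ?case by auto
qed auto

lemma learnable_mono:
  assumes "learnable k n h S" "h \<le> h'"
  shows "learnable k n h' S"
  using assms(2,1)
proof (induction rule: dec_induct)
  case (step h')
  then show ?case by (auto intro: learnable_subset)
qed

text \<open>\<open>R s\<close> is what remains of \<open>S\<close> after the hypotheses numbered by \<open>s\<close> were refuted.\<close>

definition regions ::
    "nat \<Rightarrow> nat \<Rightarrow> nat \<Rightarrow> bool list set \<Rightarrow> (nat list \<Rightarrow> bool list set) \<Rightarrow> bool" where
  "regions k n h S R \<longleftrightarrow> R [] = S \<and>
    (\<forall>s. set s \<subseteq> {..k} \<and> length s < h \<longrightarrow> (\<forall>x\<in>R s. \<exists>j. \<forall>i\<le>k. i \<noteq> j \<longrightarrow> x \<in> R (s @ [i]))) \<and>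
    (\<forall>s. set s \<subseteq> {..k} \<and> length s = h \<longrightarrow> (\<exists>v<n. \<forall>x\<in>R s. \<not> x ! v))"

text \<open>The recursive strategy is unrolled into a family indexed by refutation histories, which
  become the nodes of the circuit. Refuting i loses only inputs of colour i, so each input is lost
  in at most one child.\<close>

lemma learnable_regions:
  assumes "learnable k n h S"
  shows "\<exists>R. regions k n h S R"
  using assms
proof (induction h arbitrary: S)
  case 0
  then show ?case by (intro exI[of _ "\<lambda>_. S"]) (simp add: regions_def)
next
  case (Suc h)
  then obtain c :: "bool list \<Rightarrow> nat" where "\<forall>i\<le>k. learnable k n h {x \<in> S. c x \<noteq> i}" by auto
  with Suc.IH have "\<forall>i. \<exists>R. i \<le> k \<longrightarrow> regions k n h {x \<in> S. c x \<noteq> i} R" by blast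
  then obtain R where R: "\<And>i. i \<le> k \<Longrightarrow> regions k n h {x \<in> S. c x \<noteq> i} (R i)" by metis
  let ?R = "\<lambda>s. case s of [] \<Rightarrow> S | i # s \<Rightarrow> R i s"
  have "\<exists>j. \<forall>i\<le>k. i \<noteq> j \<longrightarrow> x \<in> ?R (s @ [i])"
    if "set s \<subseteq> {..k}" "length s < Suc h" "x \<in> ?R s" for s x
  proof (cases s)
    case Nil
    with that R show ?thesis by (intro exI[of _ "c x"]) (auto simp: regions_def)
  next
    case (Cons i s')
    with that R[of i] show ?thesis by (simp add: regions_def)
  qed
  moreover have "\<exists>v<n. \<forall>x\<in>?R s. \<not> x ! v" if "set s \<subseteq> {..k}" "length s = Suc h" for s
    using that R by (cases s) (auto simp: regions_def)
  ultimately show ?case by (intro exI[of _ ?R]) (auto simp: regions_def)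
qed

text \<open>The circuit is the complete tree of histories of length at most \<open>h\<close>. The
  value at node s is 0 on \<open>R s\<close>: this holds at the leaves by the choice of variable,
  and it passes up to a gate because at most one child loses the input.\<close>

lemma min_depth_le_of_learnable:
  assumes "learnable k n h (zeros n f)"
  shows "min_depth k n f \<le> enat h"
proof -
  obtain R :: "nat list \<Rightarrow> bool list set" where R: "R [] = zeros n f"
    "\<And>s x. \<lbrakk>set s \<subseteq> {..k}; length s < h; x \<in> R s\<rbrakk> \<Longrightarrow> \<exists>j. \<forall>i\<le>k. i \<noteq> j \<longrightarrow> x \<in> R (s @ [i])"
    "\<And>s. set s \<subseteq> {..k} \<Longrightarrow> length s = h \<Longrightarrow> \<exists>v<n. \<forall>x\<in>R s. \<not> x ! v"
    using learnable_regions[OF assms] unfolding regions_def by blast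
  then obtain var where var:
    "\<And>s. set s \<subseteq> {..k} \<Longrightarrow> length s = h \<Longrightarrow> var s < n \<and> (\<forall>x\<in>R s. \<not> x ! var s)"
    by metis
  define C where "C = \<lparr>nodes = to_nat ` {s. set s \<subseteq> {..k} \<and> length s \<le> h},
    label = \<lambda>v. let s = from_nat v in
      if length s = h then Var (var s) else Gate (map (\<lambda>i. to_nat (s @ [i])) [0..<k+1]),
    out = to_nat ([] :: nat list)\<rparr>"
  have nodes: "v \<in> nodes C \<longleftrightarrow> (\<exists>s. v = to_nat s \<and> set s \<subseteq> {..k} \<and> length s \<le> h)" for v
    by (auto simp: C_def)
  have label: "label C (to_nat s) =
    (if length s = h then Var (var s) else Gate (map (\<lambda>i. to_nat (s @ [i])) [0..<k+1]))"
    for s :: "nat list" by (simp add: C_def Let_def)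
  have out: "out C = to_nat ([] :: nat list)" by (simp add: C_def)
  have wire: "\<exists>(s :: nat list) i. v = to_nat s \<and> u = to_nat (s @ [i])" if "(u, v) \<in> wires C" for u v
    using that by (auto simp: wires_def nodes label split: if_splits)
  \<comment> \<open>Each wire lengthens the history by one entry. This gives both acyclicity and the
    depth bound.\<close>
  have path: "length (from_nat u :: nat list) = length (from_nat v :: nat list) + l"
    if "(u, v) \<in> wires C ^^ l" for u v l
    using that
  proof (induction l arbitrary: v)
    case (Suc l)
    then obtain w where "(u, w) \<in> wires C ^^ l" "(w, v) \<in> wires C" by auto
    with Suc.IH wire show ?case by fastforce
  qed simp
  have "acyclic (wires C)"
    unfolding acyclic_def
  proof (intro allI notI)
    fix v assume "(v, v) \<in> (wires C)\<^sup>+"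
    then obtain l where "0 < l" "(v, v) \<in> wires C ^^ l" by (auto simp: trancl_power)
    with path[of v v l] show False by simp
  qed
  moreover have "finite (nodes C)"
    using finite_lists_length_le[of "{..k}" h] by (simp add: C_def)
  moreover have "case label C v of Var i \<Rightarrow> i < n
      | Gate us \<Rightarrow> length us = k + 1 \<and> set us \<subseteq> nodes C" if "v \<in> nodes C" for v
  proof -
    from that obtain s where "v = to_nat s" "set s \<subseteq> {..k}" "length s \<le> h" by (auto simp: nodes)
    with var show ?thesis by (fastforce simp: label nodes)
  qed
  moreover have "out C \<in> nodes C" by (auto simp: nodes out)
  ultimately have C: "thr2_circuit k n C" by (simp add: thr2_circuit_def)
  have "\<not> node_value C x (to_nat s)" if "set s \<subseteq> {..k}" "length s \<le> h" "x \<in> R s" for s x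
    using that
  proof (induction "h - length s" arbitrary: s)
    case 0
    then have "length s = h" by simp
    moreover have "to_nat s \<in> nodes C" using 0 by (auto simp: nodes)
    ultimately show ?case using var[of s] 0 by (simp add: node_value_unfold[OF C] label)
  next
    case (Suc d)
    then have s: "length s < h" by simp
    from R(2)[OF Suc.prems(1) s Suc.prems(3)] obtain j
      where j: "\<And>i. i \<le> k \<Longrightarrow> i \<noteq> j \<Longrightarrow> x \<in> R (s @ [i])" by blast
    have "\<not> node_value C x (to_nat (s @ [i]))" if "i \<le> k" "i \<noteq> j" for i
      using that Suc.hyps Suc.prems s j by (intro Suc.hyps(1)) auto
    then have "\<not> THR 2 (map (node_value C x) (map (\<lambda>i. to_nat (s @ [i])) [0..<k+1]))"
      unfolding not_THR2_iff by (intro exI[of _ j]) (auto simp del: upt_Suc)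
    moreover have "to_nat s \<in> nodes C" using Suc.prems by (auto simp: nodes)
    ultimately show ?case using s by (simp add: node_value_unfold[OF C] label)
  qed
  from this[of "[]"] R(1) have "circuit_below n C f"
    by (simp add: circuit_below_def circuit_value_def out)
  moreover have "circuit_depth C \<le> h"
    unfolding circuit_depth_def
  proof (subst Max_le_iff)
    show "\<forall>l\<in>{l. \<exists>v\<in>nodes C. (\<exists>i. label C v = Var i) \<and> (v, out C) \<in> wires C ^^ l}. l \<le> h"
      using path by (fastforce simp: nodes out)
  qed (use depth_set_finite_nonempty[OF C] in auto)
  ultimately show ?thesis
    using C unfolding min_depth_def by (intro INF_lower2[of C]) auto
qed


subsection \<open>From protocols to learning strategies\<close>

text \<open>While more than k values of \<open>g\<close> remain, k + 1 of them serve as hypotheses,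
  and every refutation removes one value.\<close>

lemma learnable_reduce:
  fixes g :: "bool list \<Rightarrow> nat"
  assumes "finite (g ` S)" "card (g ` S) \<le> k + r"
    and "\<And>T. T \<subseteq> S \<Longrightarrow> card (g ` T) \<le> k \<Longrightarrow> learnable k n h T"
  shows "learnable k n (h + r) S"
  using assms
proof (induction r arbitrary: S)
  case 0
  then show ?case by simp
next
  case (Suc r)
  show ?case
  proof (cases "card (g ` S) \<le> k")
    case True
    with Suc.prems(3) show ?thesis by (blast intro: learnable_mono le_add1)
  next
    case False
    obtain e where e: "bij_betw e (g ` S) {0..<card (g ` S)}"
      using ex_bij_betw_finite_nat Suc.prems(1) by blast
    \<comment> \<open>Colours 0 to k all occur, since more than k values remain. Values numbered
      above k survive this round whatever the answer.\<close>
    let ?c = "\<lambda>x. e (g x)"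
    have "learnable k n (h + r) {x \<in> S. ?c x \<noteq> i}" if "i \<le> k" for i
    proof (rule Suc.IH)
      let ?T = "{x \<in> S. ?c x \<noteq> i}"
      show "finite (g ` ?T)" using Suc.prems(1) by (rule rev_finite_subset) auto
      have "i \<in> e ` g ` S" using e that False by (auto simp: bij_betw_def)
      then obtain x where "x \<in> S" "e (g x) = i" by auto
      then have "g x \<in> g ` S - g ` ?T" by force
      then have "g ` ?T \<subset> g ` S" by blast
      with Suc.prems(1) have "card (g ` ?T) < card (g ` S)" by (rule psubset_card_mono)
      with Suc.prems(2) show "card (g ` ?T) \<le> k + r" by simp
    qed (use Suc.prems(3) in blast)
    then show ?thesis by (auto intro!: exI[of _ ?c])
  qed
qed

abbreviation labels :: "nat \<Rightarrow> ('a \<Rightarrow> 'b) \<Rightarrow> (nat \<Rightarrow> 'a) \<Rightarrow> 'b list" where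
  "labels k g X \<equiv> map (\<lambda>j. g (X j)) [0..<k]"

lemma learnable_of_determined:
  fixes g :: "bool list \<Rightarrow> nat"
  assumes P: "solves_game k n f P" and S: "S \<subseteq> zeros n f"
    and g: "finite (g ` S)" "card (g ` S) \<le> k"
    and det: "\<And>X Y. \<lbrakk>\<forall>j<k. X j \<in> S \<and> Y j \<in> S; labels k g X = labels k g Y\<rbrakk> \<Longrightarrow> result P X = result P Y"
  shows "learnable k n 0 S"
proof (cases "S = {}")
  case True
  \<comment> \<open>Any output of the protocol is a coordinate below n, which is all that an empty
    \<open>S\<close> requires.\<close>
  have "well_formed k n P" using P by (simp add: solves_game_def)
  then have "result P X < n" for X by (induction P) auto
  with True show ?thesis by auto
next
  case False
  obtain e where e: "bij_betw e {0..<card (g ` S)} (g ` S)"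
    using ex_bij_betw_nat_finite[OF g(1)] by blast
  have "card (g ` S) > 0" using False g(1) by (simp add: card_gt_0_iff)
  \<comment> \<open>If there are fewer than k labels, the remaining parties repeat label number
    0.\<close>
  define X where "X j = (SOME x. x \<in> S \<and> g x = e (if j < card (g ` S) then j else 0))" for j
  have "\<exists>x. x \<in> S \<and> g x = e (if j < card (g ` S) then j else 0)" for j
  proof -
    have "e (if j < card (g ` S) then j else 0) \<in> g ` S"
      using e \<open>card (g ` S) > 0\<close> by (auto simp: bij_betw_def)
    then show ?thesis by auto
  qed
  from someI_ex[OF this] have X: "X j \<in> S" "g (X j) = e (if j < card (g ` S) then j else 0)" for j
    unfolding X_def by auto
  have "\<not> x ! result P X" if x: "x \<in> S" for x
  proof -
    from x have "g x \<in> e ` {0..<card (g ` S)}" using e by (auto simp: bij_betw_def)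
    then obtain j where j: "j < card (g ` S)" "g x = e j" by auto
    let ?Y = "X(j := x)"
    have "result P ?Y = result P X" by (rule det) (use X x j in auto)
    moreover have "\<forall>i<k. ?Y i \<in> zeros n f" using X x S by auto
    then have "\<not> ?Y j ! result P ?Y"
      using P j g(2) unfolding solves_game_def by (meson order_less_le_trans)
    ultimately show ?thesis by simp
  qed
  moreover have "result P X < n"
  proof -
    have "well_formed k n P" using P by (simp add: solves_game_def)
    then show ?thesis by (induction P) auto
  qed
  ultimately show ?thesis by auto
qed

text \<open>\<open>F c\<close> is the rest of the protocol for parties with label tuple
  \<open>c\<close>. One simulated bit refines a label by a binary choice for each of at most
  \<open>k ^ k\<close> tuples; hence at most \<open>k * 2 ^ (k ^ k)\<close> labels arise, and as
  many rounds cut them down to k.\<close>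

lemma learnable_simulation:
  fixes g :: "bool list \<Rightarrow> nat" and F :: "nat list \<Rightarrow> protocol"
  assumes P: "solves_game k n f P"
    and "S \<subseteq> zeros n f" "finite (g ` S)" "card (g ` S) \<le> k"
    and "\<And>c. well_formed k n (F c) \<and> protocol_depth (F c) \<le> d"
    and "\<And>X. \<forall>j<k. X j \<in> S \<Longrightarrow> result (F (labels k g X)) X = result P X"
  shows "learnable k n (d * (k * 2 ^ (k ^ k))) S"
  using assms(2-)
proof (induction d arbitrary: S g F)
  case 0
  have out: "\<exists>i. F c = Output i" for c
    using 0(4)[of c] by (cases "F c") auto
  have "learnable k n 0 S"
  proof (rule learnable_of_determined[OF P 0(1-3)])
    fix X Y assume XY: "\<forall>j<k. X j \<in> S \<and> Y j \<in> S" "labels k g X = labels k g Y"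
    obtain i where "F (labels k g Y) = Output i" using out by blast
    moreover from this have "F (labels k g X) = Output i" by (simp only: XY(2))
    ultimately show "result P X = result P Y" using 0(5)[of X] 0(5)[of Y] XY(1) by simp
  qed
  then show ?case by simp
next
  case (Suc d)
  define K where "K = k * 2 ^ (k ^ k)"
  let ?tuples = "{c. set c \<subseteq> g ` S \<and> length c = k}"
  have fin: "finite ?tuples" by (rule finite_lists_length_eq[OF Suc.prems(2)])
  obtain cs where cs: "set cs = ?tuples" using finite_list[OF fin] by auto
  have card_cs: "card (set cs) \<le> k ^ k"
    unfolding cs card_lists_length_eq[OF Suc.prems(2)] using Suc.prems(3) by (rule power_mono) simp
  define bit where "bit c x = (case F c of Output i \<Rightarrow> False | Speak j b P0 P1 \<Rightarrow> b x)" for c x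
  \<comment> \<open>The new label records the old one and the tuples for which a speaker holding
    \<open>x\<close> would send 1. It does not depend on who holds \<open>x\<close>, so one
    labelling serves all parties.\<close>
  define g' where "g' x = to_nat (g x, filter (\<lambda>c. bit c x) cs)" for x
  \<comment> \<open>The old tuple is decoded, and the bit just sent is read from the component of
    the speaker j.\<close>
  define F' where "F' c' = (let c = map (\<lambda>a. fst (from_nat a :: nat \<times> nat list list)) c' in
    case F c of Output i \<Rightarrow> Output i
    | Speak j b P0 P1 \<Rightarrow>
        if c \<in> set (snd (from_nat (c' ! j) :: nat \<times> nat list list)) then P1 else P0)" for c'
  have decode: "map (\<lambda>a. fst (from_nat a :: nat \<times> nat list list)) (labels k g' X) = labels k g X" for X
    by (simp add: g'_def)
  have F': "well_formed k n (F' c) \<and> protocol_depth (F' c) \<le> d" for c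
    using Suc.prems(4)[of "map (\<lambda>a. fst (from_nat a :: nat \<times> nat list list)) c"]
    by (auto simp: F'_def Let_def split: protocol.splits)
  have result_F': "result (F' (labels k g' X)) X = result (F (labels k g X)) X"
    if "\<forall>j<k. X j \<in> S" for X
  proof -
    have "labels k g X \<in> set cs" using that by (auto simp: cs)
    then show ?thesis
      using Suc.prems(4)[of "labels k g X"] unfolding F'_def decode
      by (auto simp: Let_def g'_def bit_def split: protocol.splits)
  qed
  \<comment> \<open>A new label is determined by an old label and a subset of \<open>set cs\<close>,
    so the count is a product.\<close>
  let ?I = "(\<lambda>(a, A). to_nat (a, filter (\<lambda>c. c \<in> A) cs)) ` (g ` S \<times> Pow (set cs))"
  have sub: "g' ` S \<subseteq> ?I"
  proof
    fix l assume "l \<in> g' ` S"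
    then obtain x where x: "x \<in> S" "l = g' x" by auto
    have "filter (\<lambda>c. c \<in> {c \<in> set cs. bit c x}) cs = filter (\<lambda>c. bit c x) cs"
      by (rule filter_cong) auto
    with x show "l \<in> ?I"
      by (intro image_eqI[of _ _ "(g x, {c \<in> set cs. bit c x})"]) (auto simp: g'_def)
  qed
  have fin': "finite (g' ` S)" by (rule finite_subset[OF sub]) (use Suc.prems(2) in simp)
  have "card (g' ` S) \<le> card ?I"
    by (rule card_mono[OF _ sub]) (use Suc.prems(2) in simp)
  also have "\<dots> \<le> card (g ` S \<times> Pow (set cs))"
    by (rule card_image_le) (use Suc.prems(2) in simp)
  also have "\<dots> = card (g ` S) * 2 ^ card (set cs)"
    by (simp add: card_cartesian_product card_Pow)
  also have "\<dots> \<le> K"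
    unfolding K_def using Suc.prems(3) card_cs by (intro mult_le_mono power_increasing) auto
  finally have "card (g' ` S) \<le> k + K" by simp
  have "learnable k n (d * K + K) S"
  proof (rule learnable_reduce[OF fin' \<open>card (g' ` S) \<le> k + K\<close>])
    fix T assume T: "T \<subseteq> S" "card (g' ` T) \<le> k"
    show "learnable k n (d * K) T"
      unfolding K_def
    proof (rule Suc.IH[OF _ _ T(2) F'])
      show "T \<subseteq> zeros n f" using T(1) Suc.prems(1) by blast
      show "finite (g' ` T)" using fin' T(1) by (meson finite_subset image_mono)
      fix X assume "\<forall>j<k. X j \<in> T"
      with T(1) have "\<forall>j<k. X j \<in> S" by blast
      with result_F' Suc.prems(5) show "result (F' (labels k g' X)) X = result P X" by simp
    qed
  qed
  then show ?case by (simp add: K_def algebra_simps)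
qed

lemma min_depth_le_protocol_depth:
  assumes "0 < k" and P: "solves_game k n f P"
  shows "min_depth k n f \<le> enat (k * 2 ^ (k ^ k) * protocol_depth P)"
proof -
  \<comment> \<open>The simulation starts with one common label for all inputs and the whole
    protocol still to run.\<close>
  have "learnable k n (protocol_depth P * (k * 2 ^ (k ^ k))) (zeros n f)"
  proof (rule learnable_simulation[OF P, where g = "\<lambda>_. 0" and F = "\<lambda>_. P"])
    have "card ((\<lambda>_. 0 :: nat) ` zeros n f) \<le> card {0 :: nat}" by (rule card_mono) auto
    with assms(1) show "card ((\<lambda>_. 0 :: nat) ` zeros n f) \<le> k" by simp
  qed (use P in \<open>auto simp: solves_game_def intro: finite_subset[of _ "{0}"]\<close>)
  from min_depth_le_of_learnable[OF this] show ?thesis by (simp add: mult.commute)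
qed

section \<open>Comparison of the two infima\<close>

text \<open>The factor \<open>Suc K\<close> is needed for empty \<open>A\<close> and \<open>K = 0\<close>, since \<open>0 * \<infinity> = 0\<close> in \<^typ>\<open>ereal\<close>.\<close>

lemma ereal_of_enat_le_INF:
  assumes "\<And>x. x \<in> A \<Longrightarrow> a \<le> enat (K * d x)"
  shows "ereal_of_enat a \<le> ereal (real (Suc K)) * ereal_of_enat (INF x\<in>A. enat (d x))"
proof (cases "A = {}")
  case True
  then show ?thesis by (simp add: top_enat_def)
next
  case False
  \<comment> \<open>A nonempty infimum in \<open>enat\<close> is attained, by well-ordering.\<close>
  then have "(INF x\<in>A. enat (d x)) \<in> (\<lambda>x. enat (d x)) ` A"
    by (metis Inf_enat_def LeastI_ex ex_in_conv image_is_empty)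
  then obtain x where x: "x \<in> A" "(INF x\<in>A. enat (d x)) = enat (d x)" by auto
  have "a \<le> enat (Suc K * d x)"
    using assms[OF x(1)] by (rule order_trans) simp
  then have "ereal_of_enat a \<le> ereal_of_enat (enat (Suc K * d x))"
    by (simp only: ereal_of_enat_le_iff)
  then show ?thesis by (simp add: x(2) distrib_right)
qed

theorem theorem4:
  fixes k :: nat
  assumes "k \<ge> 2"
  shows "\<exists>c1 c2 :: real. c1 > 0 \<and> c2 > 0 \<and>
    (\<forall>(n :: nat) (f :: bool list \<Rightarrow> bool). f \<in> Q k n \<longrightarrow>
       ereal c1 * ereal_of_enat (min_depth k n f) \<le> ereal_of_enat (CC k n f) \<and>
       ereal_of_enat (CC k n f) \<le> ereal c2 * ereal_of_enat (min_depth k n f))"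
proof -
  define K where "K = k * 2 ^ (k ^ k)"
  have lower: "ereal (1 / real (Suc K)) * ereal_of_enat (min_depth k n f) \<le> ereal_of_enat (CC k n f)"
    for n f
  proof -
    have "ereal_of_enat (min_depth k n f) \<le> ereal (real (Suc K)) * ereal_of_enat (CC k n f)"
      unfolding CC_def
      by (rule ereal_of_enat_le_INF) (use assms min_depth_le_protocol_depth in \<open>auto simp: K_def\<close>)
    then show ?thesis
      by (cases "min_depth k n f"; cases "CC k n f") (auto simp: field_simps)
  qed
  have upper: "ereal_of_enat (CC k n f) \<le>
      ereal (real (Suc (k * (k + 1)))) * ereal_of_enat (min_depth k n f)" for n f
    unfolding min_depth_def by (rule ereal_of_enat_le_INF) (use CC_le_circuit_depth in auto)
  have "0 < 1 / real (Suc K)" "0 < real (Suc (k * (k + 1)))" by (simp_all del: of_nat_Suc)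
  with lower upper show ?thesis by blast
qed

end
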